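(* The closure of $H^1_d$ in $H^1$ (with respect to the norm $\|\cdot\|_{H^1}$) is $$H^A=\Big\{f\in H^1:\int_0^{\infty}f(x)\,dx=0\Big\}.$$
   Context: All functions are on $\mathbb{R}$. An atom with defining interval $I$ (a bounded interval) is a function $a$ with $\operatorname{supp}(a)\subseteq I$, $|a(x)|\le 1/|I|$ and $\int_I a(x)\,dx=0$. $H^1=H^1(\mathbb{R})$ is the Banach space of all $f=\sum_{j=1}^\infty\lambda_j a_j$ (convergence in $L^1$ and in the sense of distributions) with $a_j$ atoms and $\sum_j|\lambda_j|<\infty$, normed by $\|f\|_{H^1}=\inf\sum_j|\lambda_j|$, the infimum being over all such decompositions of $f$. A dyadic interval is an interval $[k2^n,(k+1)2^n)$ with $k,n\in\mathbb{Z}$. $H^1_d$ (dyadic $H^1$) is the space defined in the same way as $H^1$ but using only atoms whose defining intervals are dyadic (dyadic atoms). *)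

theory Defs
  imports "HOL-Analysis.Analysis"
begin

text \<open>
  Functions are real-valued, on the real line, and measurability and integrals refer to Lebesgue
  measure. Elements of \<open>L\<^sup>1\<close> and \<open>H\<^sup>1\<close> are represented by functions rather than by classes modulo
  equality almost everywhere; the spaces below contain, with a function, all functions equal to it
  almost everywhere.
\<close>

definition bounded_intervals :: "real set set" where
  "bounded_intervals = {I. is_interval I \<and> bounded I \<and> measure lebesgue I > 0}"

definition dyadic_intervals :: "real set set" where
  "dyadic_intervals =
     {{of_int k * 2 powi n ..< (of_int k + 1) * 2 powi n} | (k :: int) (n :: int). True}"

text \<open>
  The support condition means that \<open>a\<close> vanishes off \<open>I\<close>. Requiring the closed support to lie in \<open>I\<close>
  would exclude Haar functions, because dyadic intervals are half-open.
\<close>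

definition atom_on :: "real set \<Rightarrow> (real \<Rightarrow> real) \<Rightarrow> bool" where
  "atom_on I a \<longleftrightarrow>
     a \<in> borel_measurable lebesgue \<and>
     (\<forall>x. x \<notin> I \<longrightarrow> a x = 0) \<and>
     (\<forall>x. \<bar>a x\<bar> \<le> 1 / measure lebesgue I) \<and>
     (LINT x:I|lebesgue. a x) = 0"

definition test_function :: "(real \<Rightarrow> real) \<Rightarrow> bool" where
  "test_function \<phi> \<longleftrightarrow>
     (\<forall>n. (deriv ^^ n) \<phi> differentiable_on UNIV) \<and> compact (closure {x. \<phi> x \<noteq> 0})"

definition L1_convergent_to :: "(nat \<Rightarrow> real \<Rightarrow> real) \<Rightarrow> (real \<Rightarrow> real) \<Rightarrow> bool" where
  "L1_convergent_to s f \<longleftrightarrow>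
     (\<forall>n. integrable lebesgue (s n)) \<and> integrable lebesgue f \<and>
     (\<lambda>n. LINT x|lebesgue. \<bar>s n x - f x\<bar>) \<longlonglongrightarrow> 0"

definition distribution_convergent_to :: "(nat \<Rightarrow> real \<Rightarrow> real) \<Rightarrow> (real \<Rightarrow> real) \<Rightarrow> bool" where
  "distribution_convergent_to s f \<longleftrightarrow>
     (\<forall>\<phi>. test_function \<phi> \<longrightarrow>
        (\<lambda>n. LINT x|lebesgue. s n x * \<phi> x) \<longlonglongrightarrow> (LINT x|lebesgue. f x * \<phi> x))"

text \<open>Here \<open>\<J>\<close> is the collection of admissible defining intervals.\<close>

definition atomic_decomposition ::
    "real set set \<Rightarrow> (real \<Rightarrow> real) \<Rightarrow> (nat \<Rightarrow> real) \<Rightarrow> (nat \<Rightarrow> real \<Rightarrow> real) \<Rightarrow> bool" where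
  "atomic_decomposition \<J> f c a \<longleftrightarrow>
     (\<forall>j. \<exists>I\<in>\<J>. atom_on I (a j)) \<and>
     summable (\<lambda>j. \<bar>c j\<bar>) \<and>
     L1_convergent_to (\<lambda>n x. \<Sum>j<n. c j * a j x) f \<and>
     distribution_convergent_to (\<lambda>n x. \<Sum>j<n. c j * a j x) f"

definition atomic_space :: "real set set \<Rightarrow> (real \<Rightarrow> real) set" where
  "atomic_space \<J> = {f. \<exists>c a. atomic_decomposition \<J> f c a}"

definition H1 :: "(real \<Rightarrow> real) set" where
  "H1 = atomic_space bounded_intervals"

definition H1_dyadic :: "(real \<Rightarrow> real) set" where
  "H1_dyadic = atomic_space dyadic_intervals"

definition H1_norm :: "(real \<Rightarrow> real) \<Rightarrow> real" where
  "H1_norm f = Inf {\<Sum>j. \<bar>c j\<bar> | c a. atomic_decomposition bounded_intervals f c a}"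

text \<open>
  The norm topology. On functions, as opposed to classes, the norm only gives a pseudometric, so
  \<open>Metric_space.mtopology\<close> does not apply; open sets are defined by balls in the same way.
\<close>

definition H1_topology :: "(real \<Rightarrow> real) topology" where
  "H1_topology = topology (\<lambda>U. U \<subseteq> H1 \<and>
     (\<forall>f\<in>U. \<exists>r>0. {g \<in> H1. H1_norm (\<lambda>x. f x - g x) < r} \<subseteq> U))"

lemma openin_H1_topology:
  "openin H1_topology U \<longleftrightarrow> U \<subseteq> H1 \<and>
     (\<forall>f\<in>U. \<exists>r>0. {g \<in> H1. H1_norm (\<lambda>x. f x - g x) < r} \<subseteq> U)"
proof -
  let ?B = "\<lambda>f r. {g \<in> H1. H1_norm (\<lambda>x. f x - g x) < r}"
  let ?P = "\<lambda>U. U \<subseteq> H1 \<and> (\<forall>f\<in>U. \<exists>r>0. ?B f r \<subseteq> U)"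
  have "istopology ?P"
    unfolding istopology_def
  proof (intro conjI allI impI)
    fix S T assume S: "?P S" and T: "?P T"
    show "S \<inter> T \<subseteq> H1" using S by blast
    show "\<forall>f\<in>S \<inter> T. \<exists>r>0. ?B f r \<subseteq> S \<inter> T"
    proof
      fix f assume f: "f \<in> S \<inter> T"
      obtain r where r: "r > 0" "?B f r \<subseteq> S" using S f by blast
      obtain q where q: "q > 0" "?B f q \<subseteq> T" using T f by blast
      have "?B f (min r q) \<subseteq> S \<inter> T" using r(2) q(2) by auto
      moreover have "min r q > 0" using r(1) q(1) by simp
      ultimately show "\<exists>r>0. ?B f r \<subseteq> S \<inter> T" by blast
    qed
  next
    fix K assume K: "\<forall>U\<in>K. ?P U"
    show "\<Union>K \<subseteq> H1" using K by blast
    show "\<forall>f\<in>\<Union>K. \<exists>r>0. ?B f r \<subseteq> \<Union>K"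
    proof
      fix f assume "f \<in> \<Union>K"
      then obtain U where U: "U \<in> K" "f \<in> U" by blast
      then obtain r where "r > 0" "?B f r \<subseteq> U" using K by blast
      then show "\<exists>r>0. ?B f r \<subseteq> \<Union>K" using U(1) by blast
    qed
  qed
  then show ?thesis
    unfolding H1_topology_def by (simp add: topology_inverse')
qed

lemma topspace_H1_topology: "topspace H1_topology = H1"
proof
  show "topspace H1_topology \<subseteq> H1"
    using openin_topspace[of H1_topology] unfolding openin_H1_topology by blast
  have "openin H1_topology H1"
    unfolding openin_H1_topology by (auto intro!: exI[of _ 1])
  then show "H1 \<subseteq> topspace H1_topology"
    by (rule openin_subset)
qed

end

theory Submission imports Defs begin

text \<open>
  The functional \<open>f \<mapsto> \<integral>\<^sub>0\<^sup>\<infinity> f\<close> is bounded by the \<open>L\<^sup>1\<close> norm, hence by the \<open>H\<^sup>1\<close> norm. A dyadic interval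
  does not cross the origin, so the functional vanishes on dyadic atoms, therefore on \<open>H\<^sup>1\<^sub>d\<close>, and by
  continuity on its closure.

  Conversely, let \<open>f = \<Sum>\<^sub>j c\<^sub>j a\<^sub>j\<close> have \<open>\<integral>\<^sub>0\<^sup>\<infinity> f = 0\<close>, and let \<open>s\<close> be a partial sum whose tail
  \<open>\<Sum>\<^sub>j\<^sub>\<ge>\<^sub>N \<bar>c\<^sub>j\<bar>\<close> is small. Then \<open>t = \<integral>\<^sub>0\<^sup>\<infinity> s\<close> is small too. Subtracting \<open>2t\<close> times the single atom
  \<open>(1\<^sub>[\<^sub>0\<^sub>,\<^sub>1\<^sub>) - 1\<^sub>[\<^sub>-\<^sub>1\<^sub>,\<^sub>0\<^sub>)) / 2\<close> from \<open>s\<close> changes it little in \<open>H\<^sup>1\<close> and gives a bounded function \<open>g\<close> of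
  bounded support whose integrals over both half-lines are zero. The restrictions of \<open>g\<close> to
  \<open>[0, 2\<^sup>n)\<close> and \<open>[-2\<^sup>n, 0)\<close>, for \<open>n\<close> large, are multiples of dyadic atoms, so \<open>g \<in> H\<^sup>1\<^sub>d\<close>
  (lemma \<open>bounded_mean_zero_in_H1_dyadic\<close>).
\<close>

section \<open>Convergence in the mean\<close>

lemma test_function_bounded:
  assumes "test_function \<phi>"
  obtains B where "\<And>x. \<bar>\<phi> x\<bar> \<le> B" "\<phi> \<in> borel_measurable lebesgue"
proof -
  have "(deriv ^^ 0) \<phi> differentiable_on UNIV" and K: "compact (closure {x. \<phi> x \<noteq> 0})"
    using assms unfolding test_function_def by blast+
  then have cont: "continuous_on UNIV \<phi>"
    by (simp add: differentiable_imp_continuous_on)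
  then have "compact (\<phi> ` closure {x. \<phi> x \<noteq> 0})"
    using K by (meson compact_continuous_image continuous_on_subset subset_UNIV)
  then obtain B where B: "\<forall>y\<in>\<phi> ` closure {x. \<phi> x \<noteq> 0}. norm y \<le> B"
    using compact_imp_bounded bounded_iff by blast
  have "\<bar>\<phi> x\<bar> \<le> max B 0" for x
  proof (cases "\<phi> x = 0")
    case False
    then have "x \<in> closure {x. \<phi> x \<noteq> 0}"
      using closure_subset[of "{x. \<phi> x \<noteq> 0}"] by auto
    then show ?thesis using B by fastforce
  qed simp
  moreover have "\<phi> \<in> borel_measurable lebesgue"
    using cont by (simp add: borel_measurable_continuous_onI measurable_completion)
  ultimately show ?thesis using that by blast
qed

text \<open>
  Test functions are bounded, so the requirement of convergence in the sense of distributions is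
  implied by convergence in \<open>L\<^sup>1\<close>.
\<close>

lemma L1_imp_distribution_convergent:
  assumes "L1_convergent_to s f"
  shows "distribution_convergent_to s f"
  unfolding distribution_convergent_to_def
proof (intro allI impI)
  fix \<phi> assume "test_function \<phi>"
  then obtain B where B: "\<And>x. \<bar>\<phi> x\<bar> \<le> B" and meas[measurable]: "\<phi> \<in> borel_measurable lebesgue"
    using test_function_bounded by blast
  have int: "\<And>n. integrable lebesgue (s n)" "integrable lebesgue f"
    and lim: "(\<lambda>n. LINT x|lebesgue. \<bar>s n x - f x\<bar>) \<longlonglongrightarrow> 0"
    using assms unfolding L1_convergent_to_def by auto
  have int_mult: "integrable lebesgue (\<lambda>x. h x * \<phi> x)" if h: "integrable lebesgue h" for h
  proof (rule Bochner_Integration.integrable_bound)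
    show "integrable lebesgue (\<lambda>x. B * h x)"
      using h by simp
    show "(\<lambda>x. h x * \<phi> x) \<in> borel_measurable lebesgue"
      using h by (auto intro: borel_measurable_times meas)
    show "AE x in lebesgue. norm (h x * \<phi> x) \<le> norm (B * h x)"
    proof (rule AE_I2)
      fix x
      have "\<bar>\<phi> x\<bar> \<le> \<bar>B\<bar>" using B[of x] by linarith
      then show "norm (h x * \<phi> x) \<le> norm (B * h x)"
        by (simp add: abs_mult mult.commute[of _ "\<bar>\<phi> x\<bar>"] mult_right_mono)
    qed
  qed
  have bound: "norm ((LINT x|lebesgue. s n x * \<phi> x) - (LINT x|lebesgue. f x * \<phi> x))
      \<le> B * (LINT x|lebesgue. \<bar>s n x - f x\<bar>)" for n
  proof -
    have "(LINT x|lebesgue. s n x * \<phi> x) - (LINT x|lebesgue. f x * \<phi> x)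
        = (LINT x|lebesgue. s n x * \<phi> x - f x * \<phi> x)"
      by (rule Bochner_Integration.integral_diff[symmetric]) (intro int_mult int)+
    also have "norm \<dots> \<le> (LINT x|lebesgue. B * \<bar>s n x - f x\<bar>)"
    proof (rule Bochner_Integration.integral_norm_bound_integral)
      show "integrable lebesgue (\<lambda>x. s n x * \<phi> x - f x * \<phi> x)"
        by (intro Bochner_Integration.integrable_diff int_mult int)
      show "integrable lebesgue (\<lambda>x. B * \<bar>s n x - f x\<bar>)"
        using int by simp
      fix x
      have "norm (s n x * \<phi> x - f x * \<phi> x) = \<bar>s n x - f x\<bar> * \<bar>\<phi> x\<bar>"
        by (simp add: left_diff_distrib[symmetric] abs_mult)
      also have "\<dots> \<le> \<bar>s n x - f x\<bar> * B"
        by (rule mult_left_mono[OF B]) simp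
      finally show "norm (s n x * \<phi> x - f x * \<phi> x) \<le> B * \<bar>s n x - f x\<bar>"
        by (simp add: mult.commute)
    qed
    finally show ?thesis by simp
  qed
  have "(\<lambda>n. (LINT x|lebesgue. s n x * \<phi> x) - (LINT x|lebesgue. f x * \<phi> x)) \<longlonglongrightarrow> 0"
    by (rule Lim_null_comparison[OF always_eventually tendsto_mult_right_zero[OF lim]])
      (use bound in blast)
  then show "(\<lambda>n. LINT x|lebesgue. s n x * \<phi> x) \<longlonglongrightarrow> (LINT x|lebesgue. f x * \<phi> x)"
    by (simp add: LIM_zero_iff)
qed

lemma set_integral_diff_le_L1:
  fixes f g :: "real \<Rightarrow> real"
  assumes f: "integrable lebesgue f" and g: "integrable lebesgue g" and A: "A \<in> sets lebesgue"
  shows "\<bar>(LINT x:A|lebesgue. f x) - (LINT x:A|lebesgue. g x)\<bar> \<le> (LINT x|lebesgue. \<bar>f x - g x\<bar>)"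
proof -
  have i: "integrable lebesgue (\<lambda>x. indicat_real A x *\<^sub>R h x)" if "integrable lebesgue h"
    for h :: "real \<Rightarrow> real"
    using integrable_mult_indicator[OF A that] .
  have "(LINT x:A|lebesgue. f x) - (LINT x:A|lebesgue. g x)
      = (LINT x|lebesgue. indicat_real A x *\<^sub>R f x - indicat_real A x *\<^sub>R g x)"
    unfolding set_lebesgue_integral_def
    by (rule Bochner_Integration.integral_diff[symmetric]) (intro i f g)+
  also have "norm \<dots> \<le> (LINT x|lebesgue. \<bar>f x - g x\<bar>)"
  proof (rule Bochner_Integration.integral_norm_bound_integral)
    show "integrable lebesgue (\<lambda>x. indicat_real A x *\<^sub>R f x - indicat_real A x *\<^sub>R g x)"
      by (intro Bochner_Integration.integrable_diff i f g)
    show "integrable lebesgue (\<lambda>x. \<bar>f x - g x\<bar>)"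
      using f g by simp
  qed (simp add: indicator_def)
  finally show ?thesis by simp
qed

lemma L1_convergent_set_integral:
  assumes "L1_convergent_to s f" and "A \<in> sets lebesgue"
  shows "(\<lambda>n. LINT x:A|lebesgue. s n x) \<longlonglongrightarrow> (LINT x:A|lebesgue. f x)"
proof -
  have "(\<lambda>n. (LINT x:A|lebesgue. s n x) - (LINT x:A|lebesgue. f x)) \<longlonglongrightarrow> 0"
    by (rule Lim_null_comparison[where g = "\<lambda>n. LINT x|lebesgue. \<bar>s n x - f x\<bar>"])
      (use assms set_integral_diff_le_L1 in \<open>auto simp: L1_convergent_to_def\<close>)
  then show ?thesis by (simp add: LIM_zero_iff)
qed

section \<open>Bounded functions of bounded support and mean zero\<close>

text \<open>
  The bounded measurable functions of mean zero that vanish off a bounded set; these are the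
  multiples of atoms, and unlike atoms they visibly form a vector space.
\<close>

definition bounded_mean_zero :: "(real \<Rightarrow> real) set" where
  "bounded_mean_zero = {g. g \<in> borel_measurable lebesgue \<and> (\<exists>M. \<forall>x. \<bar>g x\<bar> \<le> M) \<and>
     (\<exists>R. \<forall>x. \<bar>x\<bar> > R \<longrightarrow> g x = 0) \<and> (LINT x|lebesgue. g x) = 0}"

lemma integrable_bounded_mean_zero:
  assumes "g \<in> bounded_mean_zero"
  shows "integrable lebesgue g"
proof -
  obtain M R where meas: "g \<in> borel_measurable lebesgue" and M: "\<And>x. \<bar>g x\<bar> \<le> M"
    and R: "\<And>x. \<bar>x\<bar> > R \<Longrightarrow> g x = 0"
    using assms unfolding bounded_mean_zero_def by blast
  show ?thesis
  proof (rule Bochner_Integration.integrable_bound[OF _ meas])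
    have "cbox (-R) R \<in> lmeasurable" by (rule lmeasurable_cbox)
    then show "integrable lebesgue (\<lambda>x. M * indicat_real (cbox (-R) R) x)"
      by (intro integrable_mult_right integrable_real_indicator) (auto simp: fmeasurable_def)
    show "AE x in lebesgue. norm (g x) \<le> norm (M * indicat_real (cbox (-R) R) x)"
    proof (rule AE_I2)
      fix x
      show "norm (g x) \<le> norm (M * indicat_real (cbox (-R) R) x)"
      proof (cases "\<bar>x\<bar> > R")
        case True
        then show ?thesis using R by simp
      next
        case False
        then have "x \<in> cbox (-R) R" by auto
        then show ?thesis using M[of x] by simp
      qed
    qed
  qed
qed

lemma bounded_mean_zero_lincomb:
  assumes f: "f \<in> bounded_mean_zero" and g: "g \<in> bounded_mean_zero"
  shows "(\<lambda>x. f x + t * g x) \<in> bounded_mean_zero"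
proof -
  obtain M R where 1: "f \<in> borel_measurable lebesgue" "\<And>x. \<bar>f x\<bar> \<le> M"
    "\<And>x. \<bar>x\<bar> > R \<Longrightarrow> f x = 0" "(LINT x|lebesgue. f x) = 0"
    using f unfolding bounded_mean_zero_def by blast
  obtain M' R' where 2: "g \<in> borel_measurable lebesgue" "\<And>x. \<bar>g x\<bar> \<le> M'"
    "\<And>x. \<bar>x\<bar> > R' \<Longrightarrow> g x = 0" "(LINT x|lebesgue. g x) = 0"
    using g unfolding bounded_mean_zero_def by blast
  have "\<bar>f x + t * g x\<bar> \<le> M + \<bar>t\<bar> * M'" for x
  proof -
    have "\<bar>t * g x\<bar> \<le> \<bar>t\<bar> * M'"
      using 2(2)[of x] by (simp add: abs_mult mult_left_mono)
    then show ?thesis using 1(2)[of x] by linarith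
  qed
  moreover have "\<forall>x. \<bar>x\<bar> > max R R' \<longrightarrow> f x + t * g x = 0"
    using 1(3) 2(3) by simp
  moreover have "(LINT x|lebesgue. f x + t * g x) = 0"
    using integrable_bounded_mean_zero[OF f] integrable_bounded_mean_zero[OF g] 1(4) 2(4) by simp
  moreover have "(\<lambda>x. f x + t * g x) \<in> borel_measurable lebesgue"
    using 1(1) 2(1) by simp
  ultimately show ?thesis
    unfolding bounded_mean_zero_def by blast
qed

lemma bounded_mean_zero_sum:
  assumes "\<And>j. a j \<in> bounded_mean_zero"
  shows "(\<lambda>x. \<Sum>j<(n::nat). c j * a j x) \<in> bounded_mean_zero"
proof (induction n)
  case 0
  then show ?case by (auto simp: bounded_mean_zero_def)
next
  case (Suc n)
  then show ?case using bounded_mean_zero_lincomb[OF Suc assms[of n], of "c n"] by simp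
qed

section \<open>Atoms\<close>

lemma bounded_interval_lmeasurable:
  assumes "I \<in> bounded_intervals"
  shows "I \<in> lmeasurable" "measure lebesgue I > 0" "bounded I"
  using assms measurable_convex[of I]
  by (auto simp: bounded_intervals_def is_interval_convex)

lemma dyadic_interval_measure:
  "measure lebesgue {real_of_int k * 2 powi n ..< (real_of_int k + 1) * 2 powi n} = 2 powi n"
proof -
  have "real_of_int k * 2 powi n \<le> (real_of_int k + 1) * 2 powi n"
    by (simp add: mult_right_mono)
  then show ?thesis by (simp add: algebra_simps)
qed

lemma dyadic_intervals_subset: "dyadic_intervals \<subseteq> bounded_intervals"
proof
  fix I assume "I \<in> dyadic_intervals"
  then obtain k n where I: "I = {real_of_int k * 2 powi n ..< (real_of_int k + 1) * 2 powi n}"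
    unfolding dyadic_intervals_def by blast
  have "measure lebesgue I = 2 powi n"
    unfolding I by (rule dyadic_interval_measure)
  moreover have "is_interval I" "bounded I"
    unfolding I by (simp_all add: is_interval_co)
  ultimately show "I \<in> bounded_intervals"
    by (simp add: bounded_intervals_def)
qed

lemma atom_on_bounded_mean_zero:
  assumes "I \<in> bounded_intervals" and a: "atom_on I a"
  shows "a \<in> bounded_mean_zero"
proof -
  obtain R where R: "\<forall>x\<in>I. norm x \<le> R"
    using bounded_interval_lmeasurable(3)[OF assms(1)] bounded_iff by blast
  have "a x = 0" if "\<bar>x\<bar> > R" for x
  proof -
    have "x \<notin> I" using R that by auto
    then show ?thesis using a by (simp add: atom_on_def)
  qed
  moreover have "(LINT x|lebesgue. a x) = (LINT x:I|lebesgue. a x)"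
    unfolding set_lebesgue_integral_def using a
    by (intro Bochner_Integration.integral_cong) (auto simp: atom_on_def indicator_def)
  ultimately show ?thesis
    using a unfolding bounded_mean_zero_def atom_on_def by auto
qed

lemma atom_on_L1_le:
  assumes I: "I \<in> bounded_intervals" and a: "atom_on I a"
  shows "(LINT x|lebesgue. \<bar>a x\<bar>) \<le> 1"
proof -
  note m = bounded_interval_lmeasurable[OF I]
  have "(LINT x|lebesgue. \<bar>a x\<bar>) \<le> (LINT x|lebesgue. (1 / measure lebesgue I) * indicat_real I x)"
  proof (rule integral_mono)
    show "integrable lebesgue (\<lambda>x. \<bar>a x\<bar>)"
      using integrable_bounded_mean_zero[OF atom_on_bounded_mean_zero[OF I a]] by simp
    show "integrable lebesgue (\<lambda>x. (1 / measure lebesgue I) * indicat_real I x)"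
      using m(1) by (intro integrable_mult_right integrable_real_indicator) (auto simp: fmeasurable_def)
    show "\<bar>a x\<bar> \<le> (1 / measure lebesgue I) * indicat_real I x" for x
      using a by (cases "x \<in> I") (auto simp: atom_on_def)
  qed
  also have "\<dots> = 1" using m by simp
  finally show ?thesis .
qed

text \<open>A dyadic interval lies on one side of the origin.\<close>

lemma dyadic_atom_half_line_integral:
  assumes "I \<in> dyadic_intervals" and a: "atom_on I a"
  shows "(LINT x:{0..}|lebesgue. a x) = 0"
proof -
  obtain k n where I: "I = {real_of_int k * 2 powi n ..< (real_of_int k + 1) * 2 powi n}"
    using assms(1) unfolding dyadic_intervals_def by blast
  show ?thesis
  proof (cases "k \<ge> 0")
    case True
    then have "0 \<le> real_of_int k * 2 powi n" by simp
    then have "I \<subseteq> {0..}" unfolding I by auto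
    then have "(LINT x:{0..}|lebesgue. a x) = (LINT x:I|lebesgue. a x)"
      unfolding set_lebesgue_integral_def using a
      by (intro Bochner_Integration.integral_cong) (auto simp: atom_on_def indicator_def)
    then show ?thesis using a by (simp add: atom_on_def)
  next
    case False
    then have "real_of_int k + 1 \<le> 0" by linarith
    then have "(real_of_int k + 1) * 2 powi n \<le> 0"
      by (simp add: mult_nonpos_nonneg)
    then have "a x = 0" if "x \<ge> 0" for x
      using a that unfolding atom_on_def I by auto
    then have "(LINT x:{0..}|lebesgue. a x) = (LINT x::real|lebesgue. 0)"
      unfolding set_lebesgue_integral_def
      by (intro Bochner_Integration.integral_cong) (auto simp: indicator_def)
    then show ?thesis by simp
  qed
qed

section \<open>Atomic decompositions\<close>

lemma atomic_decompositionI: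
  assumes "\<And>j. \<exists>I\<in>\<J>. atom_on I (a j)" and "summable (\<lambda>j. \<bar>c j\<bar>)"
    and "L1_convergent_to (\<lambda>n x. \<Sum>j<n. c j * a j x) f"
  shows "atomic_decomposition \<J> f c a"
  using assms L1_imp_distribution_convergent unfolding atomic_decomposition_def by blast

lemma atomic_space_mono: "\<J> \<subseteq> \<K> \<Longrightarrow> atomic_space \<J> \<subseteq> atomic_space \<K>"
  unfolding atomic_space_def atomic_decomposition_def by blast

lemma H1_dyadic_subset_H1: "H1_dyadic \<subseteq> H1"
  unfolding H1_dyadic_def H1_def by (rule atomic_space_mono[OF dyadic_intervals_subset])

lemma atomic_decomposition_single:
  assumes \<J>: "\<J> \<subseteq> bounded_intervals" and I: "I \<in> \<J>" and a: "atom_on I a"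
  shows "atomic_decomposition \<J> a (\<lambda>j. if j = 0 then 1 else 0) (\<lambda>_. a)"
proof (rule atomic_decompositionI)
  show "\<exists>I\<in>\<J>. atom_on I a" using I a by blast
  show "summable (\<lambda>j::nat. \<bar>if j = 0 then 1 else 0 :: real\<bar>)"
    by (rule summable_finite[of "{0}"]) auto
  have int: "integrable lebesgue a"
    using atom_on_bounded_mean_zero[OF _ a] I \<J> integrable_bounded_mean_zero by blast
  have s: "(\<Sum>j<n. (if j = 0 then 1 else 0) * a x) = (if n = 0 then 0 else a x)" for n :: nat and x
    by (induction n) auto
  have "(\<lambda>n. LINT x|lebesgue. \<bar>(if n = 0 then 0 else a x) - a x\<bar>) \<longlonglongrightarrow> 0"
    by (rule tendsto_eventually) (use eventually_gt_at_top[of "0::nat"] in eventually_elim, simp)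
  moreover have "integrable lebesgue (\<lambda>x. if n = 0 then 0 else a x)" for n :: nat
    using int by (cases "n = 0") auto
  ultimately show "L1_convergent_to (\<lambda>n x. \<Sum>j<n. (if j = 0 then 1 else 0) * a x) a"
    unfolding L1_convergent_to_def s using int by blast
qed

lemma sum_interleave:
  fixes u v :: "nat \<Rightarrow> real"
  shows "(\<Sum>j<n. if even j then u (j div 2) else v (j div 2))
    = (\<Sum>j<Suc n div 2. u j) + (\<Sum>j<n div 2. v j)"
proof (induction n)
  case (Suc n)
  then show ?case
    by (cases "even n") (auto elim!: evenE oddE)
qed simp

text \<open>Decompositions are combined by interleaving their terms.\<close>

lemma atomic_decomposition_lincomb:
  assumes f: "atomic_decomposition \<J> f c a" and g: "atomic_decomposition \<J> g d b"
  obtains e h where "atomic_decomposition \<J> (\<lambda>x. f x + t * g x) e h"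
    and "(\<Sum>j. \<bar>e j\<bar>) = (\<Sum>j. \<bar>c j\<bar>) + \<bar>t\<bar> * (\<Sum>j. \<bar>d j\<bar>)"
proof -
  define e where "e j = (if even j then c (j div 2) else t * d (j div 2))" for j
  define h where "h j = (if even j then a (j div 2) else b (j div 2))" for j
  let ?s = "\<lambda>n x. \<Sum>j<n. c j * a j x" and ?r = "\<lambda>n x. \<Sum>j<n. d j * b j x"
  have f': "\<And>j. \<exists>I\<in>\<J>. atom_on I (a j)" "summable (\<lambda>j. \<bar>c j\<bar>)" "\<And>n. integrable lebesgue (?s n)"
    "integrable lebesgue f" "(\<lambda>n. LINT x|lebesgue. \<bar>?s n x - f x\<bar>) \<longlonglongrightarrow> 0"
    using f unfolding atomic_decomposition_def L1_convergent_to_def by auto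
  have g': "\<And>j. \<exists>I\<in>\<J>. atom_on I (b j)" "summable (\<lambda>j. \<bar>d j\<bar>)" "\<And>n. integrable lebesgue (?r n)"
    "integrable lebesgue g" "(\<lambda>n. LINT x|lebesgue. \<bar>?r n x - g x\<bar>) \<longlonglongrightarrow> 0"
    using g unfolding atomic_decomposition_def L1_convergent_to_def by auto
  have "(\<lambda>j. \<bar>c j\<bar>) sums (\<Sum>j. \<bar>c j\<bar>)"
    using f'(2) by (rule summable_sums)
  moreover have "(\<lambda>j. \<bar>t\<bar> * \<bar>d j\<bar>) sums (\<bar>t\<bar> * (\<Sum>j. \<bar>d j\<bar>))"
    using g'(2) by (intro sums_mult summable_sums)
  ultimately have "(\<lambda>j. if even j then \<bar>c (j div 2)\<bar> else \<bar>t\<bar> * \<bar>d ((j - 1) div 2)\<bar>)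
      sums (\<bar>t\<bar> * (\<Sum>j. \<bar>d j\<bar>) + (\<Sum>j. \<bar>c j\<bar>))"
    by (intro sums_if)
  moreover have "(\<lambda>j. if even j then \<bar>c (j div 2)\<bar> else \<bar>t\<bar> * \<bar>d ((j - 1) div 2)\<bar>) = (\<lambda>j. \<bar>e j\<bar>)"
    by (rule ext) (auto simp: e_def abs_mult elim!: oddE)
  ultimately have sums: "(\<lambda>j. \<bar>e j\<bar>) sums ((\<Sum>j. \<bar>c j\<bar>) + \<bar>t\<bar> * (\<Sum>j. \<bar>d j\<bar>))"
    by (simp add: add.commute)
  have partial: "(\<Sum>j<n. e j * h j x) = ?s (Suc n div 2) x + t * ?r (n div 2) x" for n x
  proof -
    have "(\<Sum>j<n. e j * h j x)
        = (\<Sum>j<n. if even j then c (j div 2) * a (j div 2) x else t * (d (j div 2) * b (j div 2) x))"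
      by (rule sum.cong) (auto simp: e_def h_def)
    then show ?thesis
      by (simp only: sum_distrib_left
          sum_interleave[of "\<lambda>j. c j * a j x" "\<lambda>j. t * (d j * b j x)"])
  qed
  have "\<forall>\<^sub>F n in sequentially. Z \<le> Suc n div 2" "\<forall>\<^sub>F n in sequentially. Z \<le> n div 2" for Z
    using eventually_ge_at_top[of "2 * Z"] by (eventually_elim, linarith)+
  then have half: "filterlim (\<lambda>n::nat. Suc n div 2) sequentially sequentially"
    "filterlim (\<lambda>n::nat. n div 2) sequentially sequentially"
    unfolding filterlim_at_top by blast+
  have conv: "(\<lambda>n. LINT x|lebesgue. \<bar>(\<Sum>j<n. e j * h j x) - (f x + t * g x)\<bar>) \<longlonglongrightarrow> 0"
  proof (rule Lim_null_comparison[OF always_eventually])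
    show "(\<lambda>n. (LINT x|lebesgue. \<bar>?s (Suc n div 2) x - f x\<bar>)
        + \<bar>t\<bar> * (LINT x|lebesgue. \<bar>?r (n div 2) x - g x\<bar>)) \<longlonglongrightarrow> 0"
      using filterlim_compose[OF f'(5) half(1)] filterlim_compose[OF g'(5) half(2)]
      by (intro tendsto_add_zero tendsto_mult_right_zero)
    show "\<forall>n. norm (LINT x|lebesgue. \<bar>(\<Sum>j<n. e j * h j x) - (f x + t * g x)\<bar>)
      \<le> (LINT x|lebesgue. \<bar>?s (Suc n div 2) x - f x\<bar>)
        + \<bar>t\<bar> * (LINT x|lebesgue. \<bar>?r (n div 2) x - g x\<bar>)"
    proof
      fix n
      note i = f'(3)[of "Suc n div 2"] f'(4) g'(3)[of "n div 2"] g'(4)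
      have "norm (LINT x|lebesgue. \<bar>(\<Sum>j<n. e j * h j x) - (f x + t * g x)\<bar>)
        \<le> (LINT x|lebesgue. \<bar>?s (Suc n div 2) x - f x\<bar> + \<bar>t\<bar> * \<bar>?r (n div 2) x - g x\<bar>)"
        unfolding partial
      proof (rule Bochner_Integration.integral_norm_bound_integral)
        show "integrable lebesgue (\<lambda>x. \<bar>?s (Suc n div 2) x + t * ?r (n div 2) x - (f x + t * g x)\<bar>)"
          using i by (intro integrable_abs Bochner_Integration.integrable_diff
              Bochner_Integration.integrable_add integrable_mult_right)
        show "integrable lebesgue (\<lambda>x. \<bar>?s (Suc n div 2) x - f x\<bar> + \<bar>t\<bar> * \<bar>?r (n div 2) x - g x\<bar>)"
          using i by (intro integrable_abs Bochner_Integration.integrable_diff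
              Bochner_Integration.integrable_add integrable_mult_right)
        fix x
        have "?s (Suc n div 2) x + t * ?r (n div 2) x - (f x + t * g x)
            = (?s (Suc n div 2) x - f x) + t * (?r (n div 2) x - g x)"
          by (simp add: algebra_simps)
        then have "\<bar>?s (Suc n div 2) x + t * ?r (n div 2) x - (f x + t * g x)\<bar>
            \<le> \<bar>?s (Suc n div 2) x - f x\<bar> + \<bar>t * (?r (n div 2) x - g x)\<bar>"
          by (simp only: abs_triangle_ineq)
        then show "norm \<bar>?s (Suc n div 2) x + t * ?r (n div 2) x - (f x + t * g x)\<bar>
            \<le> \<bar>?s (Suc n div 2) x - f x\<bar> + \<bar>t\<bar> * \<bar>?r (n div 2) x - g x\<bar>"
          by (simp only: abs_mult real_norm_def abs_idempotent)
      qed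
      also have "\<dots> = (LINT x|lebesgue. \<bar>?s (Suc n div 2) x - f x\<bar>)
          + \<bar>t\<bar> * (LINT x|lebesgue. \<bar>?r (n div 2) x - g x\<bar>)"
        using i by (subst Bochner_Integration.integral_add)
          (auto intro!: integrable_abs Bochner_Integration.integrable_diff integrable_mult_right)
      finally show "norm (LINT x|lebesgue. \<bar>(\<Sum>j<n. e j * h j x) - (f x + t * g x)\<bar>)
        \<le> (LINT x|lebesgue. \<bar>?s (Suc n div 2) x - f x\<bar>)
          + \<bar>t\<bar> * (LINT x|lebesgue. \<bar>?r (n div 2) x - g x\<bar>)" .
    qed
  qed
  have "atomic_decomposition \<J> (\<lambda>x. f x + t * g x) e h"
  proof (rule atomic_decompositionI)
    show "\<exists>I\<in>\<J>. atom_on I (h j)" for j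
      using f'(1) g'(1) by (simp add: h_def)
    show "summable (\<lambda>j. \<bar>e j\<bar>)" using sums by (rule sums_summable)
    have "integrable lebesgue (\<lambda>x. \<Sum>j<n. e j * h j x)" for n
      unfolding partial using f'(3) g'(3)
      by (intro Bochner_Integration.integrable_add integrable_mult_right)
    moreover have "integrable lebesgue (\<lambda>x. f x + t * g x)"
      using f'(4) g'(4) by simp
    ultimately show "L1_convergent_to (\<lambda>n x. \<Sum>j<n. e j * h j x) (\<lambda>x. f x + t * g x)"
      using conv unfolding L1_convergent_to_def by blast
  qed
  then show thesis using sums_unique[OF sums, symmetric] by (rule that)
qed

lemma atomic_space_lincomb:
  assumes "f \<in> atomic_space \<J>" and "g \<in> atomic_space \<J>"
  shows "(\<lambda>x. f x + t * g x) \<in> atomic_space \<J>"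
proof -
  obtain c a d b where "atomic_decomposition \<J> f c a" "atomic_decomposition \<J> g d b"
    using assms unfolding atomic_space_def by blast
  then obtain e h where "atomic_decomposition \<J> (\<lambda>x. f x + t * g x) e h"
    by (rule atomic_decomposition_lincomb)
  then show ?thesis unfolding atomic_space_def by blast
qed

lemma atomic_decomposition_tail:
  assumes f: "atomic_decomposition \<J> f c a"
  shows "atomic_decomposition \<J> (\<lambda>x. f x - (\<Sum>j<N. c j * a j x)) (\<lambda>j. c (j + N)) (\<lambda>j. a (j + N))"
proof (rule atomic_decompositionI)
  let ?s = "\<lambda>n x. \<Sum>j<n. c j * a j x"
  have f': "\<And>j. \<exists>I\<in>\<J>. atom_on I (a j)" "summable (\<lambda>j. \<bar>c j\<bar>)" "\<And>n. integrable lebesgue (?s n)"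
    "integrable lebesgue f" "(\<lambda>n. LINT x|lebesgue. \<bar>?s n x - f x\<bar>) \<longlonglongrightarrow> 0"
    using f unfolding atomic_decomposition_def L1_convergent_to_def by auto
  show "\<exists>I\<in>\<J>. atom_on I (a (j + N))" for j by (rule f'(1))
  show "summable (\<lambda>j. \<bar>c (j + N)\<bar>)"
    using f'(2) summable_iff_shift[of "\<lambda>j. \<bar>c j\<bar>" N] by simp
  have partial: "(\<Sum>j<n. c (j + N) * a (j + N) x) = ?s (n + N) x - ?s N x" for n x
    by (induction n) auto
  have "integrable lebesgue (\<lambda>x. ?s (n + N) x - ?s N x)" for n
    using f'(3) by (intro Bochner_Integration.integrable_diff)
  moreover have "integrable lebesgue (\<lambda>x. f x - ?s N x)"
    using f'(3,4) by (intro Bochner_Integration.integrable_diff)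
  moreover have "(\<lambda>n. LINT x|lebesgue. \<bar>(?s (n + N) x - ?s N x) - (f x - ?s N x)\<bar>) \<longlonglongrightarrow> 0"
    using LIMSEQ_ignore_initial_segment[OF f'(5), of N] by simp
  ultimately show "L1_convergent_to (\<lambda>n x. \<Sum>j<n. c (j + N) * a (j + N) x) (\<lambda>x. f x - ?s N x)"
    unfolding L1_convergent_to_def partial by blast
qed

section \<open>The \<open>H\<^sup>1\<close> norm\<close>

lemma H1_norm_le:
  assumes "atomic_decomposition bounded_intervals f c a"
  shows "H1_norm f \<le> (\<Sum>j. \<bar>c j\<bar>)"
  unfolding H1_norm_def
proof (rule cInf_lower)
  show "bdd_below {\<Sum>j. \<bar>c j\<bar> | c a. atomic_decomposition bounded_intervals f c a}"
    by (rule bdd_belowI[of _ 0]) (auto simp: atomic_decomposition_def intro!: suminf_nonneg)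
qed (use assms in blast)

lemma atomic_decomposition_L1_le:
  assumes "atomic_decomposition bounded_intervals f c a"
  shows "(LINT x|lebesgue. \<bar>f x\<bar>) \<le> (\<Sum>j. \<bar>c j\<bar>)"
proof -
  let ?s = "\<lambda>n x. \<Sum>j<n. c j * a j x"
  have f': "\<And>j. \<exists>I\<in>bounded_intervals. atom_on I (a j)" "summable (\<lambda>j. \<bar>c j\<bar>)"
    "\<And>n. integrable lebesgue (?s n)"
    "integrable lebesgue f" "(\<lambda>n. LINT x|lebesgue. \<bar>?s n x - f x\<bar>) \<longlonglongrightarrow> 0"
    using assms unfolding atomic_decomposition_def L1_convergent_to_def by auto
  have int: "integrable lebesgue (a j)" for j
    using f'(1)[of j] atom_on_bounded_mean_zero integrable_bounded_mean_zero by blast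
  have le1: "(LINT x|lebesgue. \<bar>a j x\<bar>) \<le> 1" for j
    using f'(1)[of j] atom_on_L1_le by blast
  have "(LINT x|lebesgue. \<bar>?s n x\<bar>) \<le> (\<Sum>j. \<bar>c j\<bar>)" for n
  proof -
    have "(LINT x|lebesgue. \<bar>?s n x\<bar>) \<le> (LINT x|lebesgue. (\<Sum>j<n. \<bar>c j\<bar> * \<bar>a j x\<bar>))"
    proof (rule integral_mono)
      show "integrable lebesgue (\<lambda>x. \<bar>?s n x\<bar>)" using f'(3) by (rule integrable_abs)
      show "integrable lebesgue (\<lambda>x. \<Sum>j<n. \<bar>c j\<bar> * \<bar>a j x\<bar>)" using int by simp
      show "\<bar>?s n x\<bar> \<le> (\<Sum>j<n. \<bar>c j\<bar> * \<bar>a j x\<bar>)" for x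
        using sum_abs[of "\<lambda>j. c j * a j x" "{..<n}"] by (simp add: abs_mult)
    qed
    also have "\<dots> = (\<Sum>j<n. \<bar>c j\<bar> * (LINT x|lebesgue. \<bar>a j x\<bar>))" using int by simp
    also have "\<dots> \<le> (\<Sum>j<n. \<bar>c j\<bar> * 1)"
      by (intro sum_mono mult_left_mono le1) simp
    also have "\<dots> \<le> (\<Sum>j. \<bar>c j\<bar>)"
      using sum_le_suminf[OF f'(2), of "{..<n}"] by simp
    finally show ?thesis .
  qed
  moreover have "(LINT x|lebesgue. \<bar>f x\<bar>)
      \<le> (LINT x|lebesgue. \<bar>?s n x - f x\<bar>) + (LINT x|lebesgue. \<bar>?s n x\<bar>)" for n
  proof -
    have "(LINT x|lebesgue. \<bar>f x\<bar>) \<le> (LINT x|lebesgue. \<bar>?s n x - f x\<bar> + \<bar>?s n x\<bar>)"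
      using f'(3)[of n] f'(4)
      by (intro integral_mono integrable_abs Bochner_Integration.integrable_add
          Bochner_Integration.integrable_diff) auto
    also have "\<dots> = (LINT x|lebesgue. \<bar>?s n x - f x\<bar>) + (LINT x|lebesgue. \<bar>?s n x\<bar>)"
      using f'(3)[of n] f'(4)
      by (intro Bochner_Integration.integral_add integrable_abs Bochner_Integration.integrable_diff)
    finally show ?thesis .
  qed
  ultimately have bound: "(LINT x|lebesgue. \<bar>f x\<bar>)
      \<le> (LINT x|lebesgue. \<bar>?s n x - f x\<bar>) + (\<Sum>j. \<bar>c j\<bar>)" for n
    by (rule order_trans[OF _ add_left_mono, rotated])
  have "(\<lambda>n. (LINT x|lebesgue. \<bar>?s n x - f x\<bar>) + (\<Sum>j. \<bar>c j\<bar>)) \<longlonglongrightarrow> 0 + (\<Sum>j. \<bar>c j\<bar>)"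
    by (intro tendsto_add f'(5) tendsto_const)
  from LIMSEQ_le_const[OF this] bound show ?thesis
    by simp
qed

lemma L1_le_H1_norm:
  assumes "f \<in> H1"
  shows "(LINT x|lebesgue. \<bar>f x\<bar>) \<le> H1_norm f"
  unfolding H1_norm_def
proof (rule cInf_greatest)
  show "{\<Sum>j. \<bar>c j\<bar> | c a. atomic_decomposition bounded_intervals f c a} \<noteq> {}"
    using assms unfolding H1_def atomic_space_def by blast
qed (auto dest: atomic_decomposition_L1_le)

lemma integrable_H1: "f \<in> H1 \<Longrightarrow> integrable lebesgue f"
  unfolding H1_def atomic_space_def atomic_decomposition_def L1_convergent_to_def by blast

lemma H1_diff:
  assumes "f \<in> H1" "g \<in> H1"
  shows "(\<lambda>x. f x - g x) \<in> H1"
  using atomic_space_lincomb[of f bounded_intervals g "-1"] assms by (simp add: H1_def)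

section \<open>The integral over the half-line\<close>

lemma half_line_integral_H1_dyadic:
  assumes "f \<in> H1_dyadic"
  shows "(LINT x:{0..}|lebesgue. f x) = 0"
proof -
  obtain c a where a: "\<And>j. \<exists>I\<in>dyadic_intervals. atom_on I (a j)"
    and conv: "L1_convergent_to (\<lambda>n x. \<Sum>j<n. c j * a j x) f"
    using assms unfolding H1_dyadic_def atomic_space_def atomic_decomposition_def by blast
  have int: "integrable lebesgue (a j)" for j
  proof -
    obtain I where "I \<in> bounded_intervals" "atom_on I (a j)"
      using a[of j] dyadic_intervals_subset by blast
    then show ?thesis
      by (intro integrable_bounded_mean_zero atom_on_bounded_mean_zero)
  qed
  have zero: "(LINT x:{0..}|lebesgue. a j x) = 0" for j
    using a[of j] dyadic_atom_half_line_integral by blast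
  have "(LINT x:{0..}|lebesgue. (\<Sum>j<n. c j * a j x)) = 0" for n
  proof -
    have "integrable lebesgue (\<lambda>x. indicat_real {0..} x * a j x)" for j
      using integrable_mult_indicator[OF _ int[of j], of "{0..}"] by simp
    moreover have "(LINT x:{0..}|lebesgue. (\<Sum>j<n. c j * a j x))
        = (LINT x|lebesgue. (\<Sum>j<n. c j * (indicat_real {0..} x * a j x)))"
      by (simp add: set_lebesgue_integral_def sum_distrib_left mult.left_commute)
    ultimately have "(LINT x:{0..}|lebesgue. (\<Sum>j<n. c j * a j x))
        = (\<Sum>j<n. c j * (LINT x:{0..}|lebesgue. a j x))"
      by (simp add: set_lebesgue_integral_def)
    also have "\<dots> = 0"
      by (simp add: zero)
    finally show ?thesis .
  qed
  then show ?thesis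
    using L1_convergent_set_integral[OF conv, of "{0..}"] by (simp add: LIMSEQ_const_iff)
qed

lemma openin_half_line_integral_nonzero:
  "openin H1_topology {f \<in> H1. (LINT x:{0..}|lebesgue. f x) \<noteq> 0}"
  unfolding openin_H1_topology
proof (intro conjI ballI)
  fix f assume "f \<in> {f \<in> H1. (LINT x:{0..}|lebesgue. f x) \<noteq> 0}"
  then have f: "f \<in> H1" and nz: "(LINT x:{0..}|lebesgue. f x) \<noteq> 0" by auto
  have "(LINT x:{0..}|lebesgue. g x) \<noteq> 0"
    if g: "g \<in> H1" and less: "H1_norm (\<lambda>x. f x - g x) < \<bar>LINT x:{0..}|lebesgue. f x\<bar>" for g
  proof -
    have "\<bar>(LINT x:{0..}|lebesgue. f x) - (LINT x:{0..}|lebesgue. g x)\<bar>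
        \<le> (LINT x|lebesgue. \<bar>f x - g x\<bar>)"
      using f g by (intro set_integral_diff_le_L1 integrable_H1) auto
    also have "\<dots> \<le> H1_norm (\<lambda>x. f x - g x)"
      by (rule L1_le_H1_norm[OF H1_diff[OF f g]])
    finally show ?thesis using less by auto
  qed
  then show "\<exists>r>0. {g \<in> H1. H1_norm (\<lambda>x. f x - g x) < r}
      \<subseteq> {f \<in> H1. (LINT x:{0..}|lebesgue. f x) \<noteq> 0}"
    using nz by (intro exI[of _ "\<bar>LINT x:{0..}|lebesgue. f x\<bar>"]) auto
qed auto

section \<open>Approximation by dyadic functions\<close>

lemma multiple_of_atom_in_atomic_space:
  assumes \<J>: "\<J> \<subseteq> bounded_intervals" and I: "I \<in> \<J>"
    and g: "g \<in> borel_measurable lebesgue" "\<And>x. x \<notin> I \<Longrightarrow> g x = 0" "\<And>x. \<bar>g x\<bar> \<le> M"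
      "(LINT x:I|lebesgue. g x) = 0"
  shows "g \<in> atomic_space \<J>"
proof -
  have pos: "measure lebesgue I > 0" using \<J> I bounded_interval_lmeasurable(2) by blast
  \<comment> \<open>The bound \<open>M\<close> may be \<open>0\<close>; \<open>M + 1\<close> is a positive bound.\<close>
  have "\<bar>g 0\<bar> \<le> M" by (rule g(3))
  then have M: "M + 1 > 0" by linarith
  define K where "K = (M + 1) * measure lebesgue I"
  have K: "K > 0" using pos M by (simp add: K_def)
  have "atom_on I (\<lambda>x. g x / K)"
    unfolding atom_on_def
  proof (intro conjI allI impI)
    fix x
    have "\<bar>g x\<bar> \<le> M + 1" using g(3)[of x] by linarith
    then have "\<bar>g x\<bar> / K \<le> (M + 1) / K"
      using K by (simp add: divide_right_mono)
    then show "\<bar>g x / K\<bar> \<le> 1 / measure lebesgue I"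
      using M K by (simp add: K_def)
  qed (use g in \<open>auto simp: set_integral_divide_zero\<close>)
  then have atom: "(\<lambda>x. g x / K) \<in> atomic_space \<J>"
    using atomic_decomposition_single[OF \<J> I] unfolding atomic_space_def by blast
  \<comment> \<open>Closure under \<open>f + t g\<close> with \<open>f = g\<close> and \<open>t = K - 1\<close> gives scaling by \<open>K\<close>.\<close>
  then have "(\<lambda>x. g x / K + (K - 1) * (g x / K)) \<in> atomic_space \<J>"
    by (intro atomic_space_lincomb)
  moreover have "g x / K + (K - 1) * (g x / K) = g x" for x
    using K by (simp add: field_simps)
  ultimately show ?thesis by simp
qed

lemma bounded_mean_zero_in_H1_dyadic:
  assumes g: "g \<in> bounded_mean_zero" and half: "(LINT x:{0..}|lebesgue. g x) = 0"
  shows "g \<in> H1_dyadic"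
proof -
  obtain M R where meas[measurable]: "g \<in> borel_measurable lebesgue" and M: "\<And>x. \<bar>g x\<bar> \<le> M"
    and R: "\<And>x. \<bar>x\<bar> > R \<Longrightarrow> g x = 0" and mean: "(LINT x|lebesgue. g x) = 0"
    using g unfolding bounded_mean_zero_def by blast
  obtain n :: nat where n: "R < 2 ^ n"
    using real_arch_pow[of 2 R] by auto
  define P where "P = {0..<2 ^ n :: real}"
  define Q where "Q = {- (2 ^ n)..<0 :: real}"
  have "P = {of_int 0 * 2 powi int n ..< (of_int 0 + 1) * 2 powi int n}"
    by (simp add: P_def)
  then have P: "P \<in> dyadic_intervals" unfolding dyadic_intervals_def by blast
  have "Q = {of_int (- 1) * 2 powi int n ..< (of_int (- 1) + 1) * 2 powi int n}"
    by (simp add: Q_def)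
  then have Q: "Q \<in> dyadic_intervals" unfolding dyadic_intervals_def by blast
  have off: "g x = 0" if "x \<notin> P" "x \<notin> Q" for x
    using that R[of x] n by (auto simp: P_def Q_def)
  define p where "p x = indicat_real P x * g x" for x
  define q where "q x = indicat_real Q x * g x" for x
  have PQ[measurable]: "P \<in> sets lebesgue" "Q \<in> sets lebesgue"
    by (auto simp: P_def Q_def)
  have int: "integrable lebesgue g" by (rule integrable_bounded_mean_zero[OF g])
  have split: "g x = p x + q x" for x
    using off[of x] by (auto simp: p_def q_def indicator_def P_def Q_def)
  have ip: "integrable lebesgue p" and iq: "integrable lebesgue q"
    unfolding p_def q_def
    using integrable_mult_indicator[OF PQ(1) int] integrable_mult_indicator[OF PQ(2) int] by auto
  have p0: "(LINT x|lebesgue. p x) = 0"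
  proof -
    have "(LINT x|lebesgue. p x) = (LINT x:{0..}|lebesgue. g x)"
      unfolding set_lebesgue_integral_def
    proof (rule Bochner_Integration.integral_cong)
      fix x show "p x = indicat_real {0..} x *\<^sub>R g x"
        using off[of x] by (auto simp: p_def indicator_def P_def Q_def)
    qed simp
    then show ?thesis using half by simp
  qed
  moreover have "(LINT x|lebesgue. p x) + (LINT x|lebesgue. q x) = 0"
    using mean ip iq by (simp add: split)
  ultimately have q0: "(LINT x|lebesgue. q x) = 0" by simp
  have "p \<in> H1_dyadic"
    unfolding H1_dyadic_def
  proof (rule multiple_of_atom_in_atomic_space[OF dyadic_intervals_subset P])
    show "p \<in> borel_measurable lebesgue" using ip by blast
    show "(LINT x:P|lebesgue. p x) = 0"
      using p0 by (simp add: set_lebesgue_integral_def p_def mult.assoc[symmetric]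
          indicator_inter_arith[symmetric])
    show "\<bar>p x\<bar> \<le> M" for x
      using M[of x] by (auto simp: p_def indicator_def)
  qed (simp add: p_def)
  moreover have "q \<in> H1_dyadic"
    unfolding H1_dyadic_def
  proof (rule multiple_of_atom_in_atomic_space[OF dyadic_intervals_subset Q])
    show "q \<in> borel_measurable lebesgue" using iq by blast
    show "(LINT x:Q|lebesgue. q x) = 0"
      using q0 by (simp add: set_lebesgue_integral_def q_def mult.assoc[symmetric]
          indicator_inter_arith[symmetric])
    show "\<bar>q x\<bar> \<le> M" for x
      using M[of x] by (auto simp: q_def indicator_def)
  qed (simp add: q_def)
  ultimately have "(\<lambda>x. p x + 1 * q x) \<in> H1_dyadic"
    unfolding H1_dyadic_def by (rule atomic_space_lincomb)
  then show ?thesis by (simp flip: split)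
qed

text \<open>
  The atom used to correct the integral over the half-line. The factor \<open>1 / 2\<close> is forced by the
  length of the defining interval \<open>[-1, 1)\<close>.
\<close>

definition jump_atom :: "real \<Rightarrow> real" where
  "jump_atom x = (indicator {0..<1} x - indicator {-1..<0} x) / 2"

lemma jump_atom_atom: "{-1..<1} \<in> bounded_intervals" "atom_on {-1..<1} jump_atom"
proof -
  show "{-1..<1::real} \<in> bounded_intervals"
    by (auto simp: bounded_intervals_def is_interval_co)
  have "(LINT x:{-1..<1}|lebesgue. jump_atom x) = (LINT x|lebesgue. jump_atom x)"
    unfolding set_lebesgue_integral_def
    by (intro Bochner_Integration.integral_cong) (auto simp: jump_atom_def indicator_def)
  also have "\<dots> = 0"
    unfolding jump_atom_def by simp
  finally have "(LINT x:{-1..<1}|lebesgue. jump_atom x) = 0" .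
  moreover have "jump_atom \<in> borel_measurable lebesgue"
    unfolding jump_atom_def
    by (intro borel_measurable_divide borel_measurable_diff borel_measurable_indicator) auto
  ultimately show "atom_on {-1..<1} jump_atom"
    by (auto simp: atom_on_def jump_atom_def indicator_def)
qed

lemma half_line_integral_jump_atom: "(LINT x:{0..}|lebesgue. jump_atom x) = 1 / 2"
proof -
  have "(LINT x:{0..}|lebesgue. jump_atom x) = (LINT x|lebesgue. indicator {0..<1::real} x / 2)"
    unfolding set_lebesgue_integral_def
    by (intro Bochner_Integration.integral_cong) (auto simp: jump_atom_def indicator_def)
  then show ?thesis by simp
qed

lemma H1_dyadic_approximation:
  assumes f: "f \<in> H1" and half: "(LINT x:{0..}|lebesgue. f x) = 0" and r: "r > 0"
  obtains g where "g \<in> H1_dyadic" "H1_norm (\<lambda>x. f x - g x) < r"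
proof -
  obtain c a where dec: "atomic_decomposition bounded_intervals f c a"
    using f unfolding H1_def atomic_space_def by blast
  define s where "s n x = (\<Sum>j<n. c j * a j x)" for n x
  define t where "t n = (LINT x:{0..}|lebesgue. s n x)" for n
  have atoms: "\<And>j. \<exists>I\<in>bounded_intervals. atom_on I (a j)" and sum: "summable (\<lambda>j. \<bar>c j\<bar>)"
    and conv: "L1_convergent_to s f"
    using dec unfolding atomic_decomposition_def s_def by auto
  have "t \<longlonglongrightarrow> 0"
    using L1_convergent_set_integral[OF conv, of "{0..}"] half by (simp add: t_def[abs_def])
  then have "(\<lambda>n. (\<Sum>j. \<bar>c (j + n)\<bar>) + \<bar>2 * t n\<bar>) \<longlonglongrightarrow> 0"
    by (intro tendsto_add_zero suminf_exist_split2[OF sum] tendsto_rabs_zero tendsto_mult_right_zero)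
  then obtain N where N: "(\<Sum>j. \<bar>c (j + N)\<bar>) + \<bar>2 * t N\<bar> < r"
    using order_tendstoD(2)[OF _ r] eventually_happens trivial_limit_sequentially by blast
  define g where "g x = s N x + (- 2 * t N) * jump_atom x" for x
  have s: "s N \<in> bounded_mean_zero"
    unfolding s_def using atoms atom_on_bounded_mean_zero by (intro bounded_mean_zero_sum) blast
  have j: "jump_atom \<in> bounded_mean_zero"
    using jump_atom_atom by (rule atom_on_bounded_mean_zero)
  have si: "set_integrable lebesgue {0..} h" if "h \<in> bounded_mean_zero" for h
    unfolding set_integrable_def
    using integrable_bounded_mean_zero[OF that] by (intro integrable_mult_indicator) auto
  have sj: "set_integrable lebesgue {0..} (\<lambda>x. (- 2 * t N) * jump_atom x)"
    by (intro set_integrable_mult_right si j)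
  have "(LINT x:{0..}|lebesgue. g x)
      = t N + (- 2 * t N) * (LINT x:{0..}|lebesgue. jump_atom x)"
    by (simp only: g_def set_integral_add(2)[OF si[OF s] sj] set_integral_mult_right
        t_def[of N, symmetric])
  then have "(LINT x:{0..}|lebesgue. g x) = 0"
    by (simp add: half_line_integral_jump_atom)
  moreover have "g \<in> bounded_mean_zero"
    unfolding g_def by (rule bounded_mean_zero_lincomb[OF s j])
  ultimately have "g \<in> H1_dyadic" by (intro bounded_mean_zero_in_H1_dyadic)
  moreover have "H1_norm (\<lambda>x. f x - g x) < r"
  proof -
    obtain e h where eh: "atomic_decomposition bounded_intervals
        (\<lambda>x. (f x - (\<Sum>j<N. c j * a j x)) + (2 * t N) * jump_atom x) e h"
      "(\<Sum>j. \<bar>e j\<bar>) = (\<Sum>j. \<bar>c (j + N)\<bar>) + \<bar>2 * t N\<bar> * (\<Sum>j::nat. \<bar>if j = 0 then 1 else 0\<bar>)"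
      using atomic_decomposition_lincomb[OF atomic_decomposition_tail[OF dec]
          atomic_decomposition_single[OF order_refl jump_atom_atom]] .
    have "(\<Sum>j::nat. \<bar>if j = 0 then 1 else 0 :: real\<bar>) = 1"
      by (subst suminf_finite[of "{0}"]) auto
    moreover have "(\<lambda>x. f x - g x) = (\<lambda>x. (f x - (\<Sum>j<N. c j * a j x)) + (2 * t N) * jump_atom x)"
      by (simp add: g_def s_def fun_eq_iff)
    ultimately show ?thesis using H1_norm_le[OF eh(1)] eh(2) N by simp
  qed
  ultimately show thesis by (rule that)
qed

theorem mainTheorem2:
  "H1_topology closure_of H1_dyadic = {f \<in> H1. (LINT x:{0..}|lebesgue. f x) = 0}"
proof (intro equalityI subsetI)
  fix f assume f: "f \<in> H1_topology closure_of H1_dyadic"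
  then have "f \<in> H1" by (simp add: in_closure_of topspace_H1_topology)
  moreover have "(LINT x:{0..}|lebesgue. f x) = 0"
  proof (rule ccontr)
    assume "(LINT x:{0..}|lebesgue. f x) \<noteq> 0"
    then have "f \<in> {f \<in> H1. (LINT x:{0..}|lebesgue. f x) \<noteq> 0}"
      using \<open>f \<in> H1\<close> by simp
    then obtain g where "g \<in> H1_dyadic" "g \<in> {f \<in> H1. (LINT x:{0..}|lebesgue. f x) \<noteq> 0}"
      using f openin_half_line_integral_nonzero unfolding in_closure_of by meson
    then show False using half_line_integral_H1_dyadic[of g] by simp
  qed
  ultimately show "f \<in> {f \<in> H1. (LINT x:{0..}|lebesgue. f x) = 0}" by simp
next
  fix f assume "f \<in> {f \<in> H1. (LINT x:{0..}|lebesgue. f x) = 0}"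
  then have f: "f \<in> H1" "(LINT x:{0..}|lebesgue. f x) = 0" by auto
  have "\<exists>g. g \<in> H1_dyadic \<and> g \<in> T" if T: "f \<in> T" "openin H1_topology T" for T
  proof -
    obtain r where r: "r > 0" "{g \<in> H1. H1_norm (\<lambda>x. f x - g x) < r} \<subseteq> T"
      using T unfolding openin_H1_topology by blast
    obtain g where "g \<in> H1_dyadic" "H1_norm (\<lambda>x. f x - g x) < r"
      using H1_dyadic_approximation[OF f r(1)] .
    then show ?thesis using r(2) H1_dyadic_subset_H1 by blast
  qed
  then show "f \<in> H1_topology closure_of H1_dyadic"
    using f(1) by (simp add: in_closure_of topspace_H1_topology)
qed

end
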